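(* Let $n,k$ be integers with $1\le k\le n$. The following are equivalent: (a) $S(n,k)$ is odd. (b) $\#([n]\cap[n-k]) = \sigma(n)-\sigma(k)$ and $\nu(S(n,k)) = \sigma(k)-\sigma(n)+\#([n]\cap[n-k])$ (i.e., $S(n,k)$ is a MZC or an AMZC). (c) $\#([n-1]\cap[n-k]) = \sigma(n-1)-\sigma(k-1)$ and $\nu(S(n,k)) = \sigma(k-1)-\sigma(n-1)+\#([n-1]\cap[n-k])$ (i.e., $S(n,k)$ is a SMZC or a SAMZC).
   Context: $S(n,k)$ denotes the Stirling number of the second kind and $\nu$ the $2$-adic valuation. For a nonnegative integer $m$, $\sigma(m)$ is the sum of the base-$2$ digits of $m$ and $[m]$ is the set of powers of $2$ in the base-$2$ expansion of $m$. Terminology: $S(n,k)$ is a MZC (minimum zero case) if $\nu(S(n,k))=\sigma(k)-\sigma(n)$; an AMZC (almost minimum zero case) if it is not a MZC and $\nu(S(n,k))=\sigma(k)-\sigma(n)+\#([n]\cap[n-k])$; a SMZC (shifted minimum zero case) if $\nu(S(n,k))=\sigma(k-1)-\sigma(n-1)$; a SAMZC (shifted almost minimum zero case) if it is not a SMZC and $\nu(S(n,k))=\sigma(k-1)-\sigma(n-1)+\#([n-1]\cap[n-k])$. It is known that $\nu(S(n,k))\ge \sigma(k)-\sigma(n)+\#([n]\cap[n-k])$ and $\nu(S(n,k))\ge\sigma(k-1)-\sigma(n-1)+\#([n-1]\cap[n-k])$. *)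

theory Defs
  imports "HOL-Computational_Algebra.Primes" "HOL-Combinatorics.Stirling"
begin

text \<open>Every nonzero binary digit of \<open>m\<close> is in a position \<open>i\<close> with \<open>2 ^ i \<le> m\<close>, hence \<open>i < m\<close>,
  so the sum below ranges over all nonzero digits.\<close>

definition digit_sum :: "nat \<Rightarrow> nat"  (\<open>\<sigma>\<close>) where
  "\<sigma> m = (\<Sum>i<m. m div 2 ^ i mod 2)"

definition binary_powers :: "nat \<Rightarrow> nat set" where
  "binary_powers m = {2 ^ i | i. m div 2 ^ i mod 2 = 1}"

definition common_powers :: "nat \<Rightarrow> nat \<Rightarrow> int" where
  "common_powers a b = int (card (binary_powers a \<inter> binary_powers b))"

text \<open>The 2-adic valuation of a Stirling number of the second kind. It is only meaningful when
  \<open>Stirling n k \<noteq> 0\<close>, as is the case for \<open>1 \<le> k \<le> n\<close>. It is integer-valued because it is compared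
  with differences of digit sums, which may be negative.\<close>

definition nu_Stirling :: "nat \<Rightarrow> nat \<Rightarrow> int" where
  "nu_Stirling n k = int (multiplicity 2 (Stirling n k))"

text \<open>(Shifted) minimum zero cases and almost minimum zero cases. These are properties of the pair
  \<open>(n, k)\<close>, not of the number \<open>Stirling n k\<close>. The shifted versions are intended for \<open>1 \<le> k \<le> n\<close>,
  where no subtraction is truncated.\<close>

definition MZC :: "nat \<Rightarrow> nat \<Rightarrow> bool" where
  "MZC n k \<longleftrightarrow> nu_Stirling n k = int (\<sigma> k) - int (\<sigma> n)"

definition AMZC :: "nat \<Rightarrow> nat \<Rightarrow> bool" where
  "AMZC n k \<longleftrightarrow> \<not> MZC n k \<and>
     nu_Stirling n k = int (\<sigma> k) - int (\<sigma> n) + common_powers n (n - k)"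

definition SMZC :: "nat \<Rightarrow> nat \<Rightarrow> bool" where
  "SMZC n k \<longleftrightarrow> nu_Stirling n k = int (\<sigma> (k - 1)) - int (\<sigma> (n - 1))"

definition SAMZC :: "nat \<Rightarrow> nat \<Rightarrow> bool" where
  "SAMZC n k \<longleftrightarrow> \<not> SMZC n k \<and>
     nu_Stirling n k = int (\<sigma> (k - 1)) - int (\<sigma> (n - 1)) + common_powers (n - 1) (n - k)"

end

theory Submission
  imports Defs
begin

unbundle bit_operations_syntax

text \<open>Disjointness of binary expansions satisfies Pascal's rule modulo 2, and so, matching the
  Stirling recurrence, \<open>Stirling (k + a) k\<close> is odd iff \<open>a\<close> and \<open>(k - 1) div 2\<close> have disjoint
  expansions. In that case, halving both summands shows that adding \<open>a\<close> to \<open>k\<close>, or to \<open>k - 1\<close>,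
  increases the digit sum by the number of binary digits that \<open>a\<close> shares with the total. Hence the
  conditions on \<open>#\<close> hold whenever \<open>Stirling n k\<close> is odd; conversely, together with the formula for
  the valuation they force it to vanish.\<close>

section \<open>Disjoint binary expansions and the parity of Stirling numbers\<close>

lemma and_eq_0_rec:
  "a AND b = 0 \<longleftrightarrow> \<not> (odd a \<and> odd b) \<and> (a div 2) AND (b div 2) = 0" for a b :: nat
  by (subst and_rec) auto

text \<open>Disjointness of \<open>a\<close> and \<open>b\<close> is oddness of
  \<open>(a + b) choose a\<close>, so this is Pascal's rule modulo 2. After halving, the induction
  hypothesis is needed only when \<open>a\<close> and \<open>b\<close> are both odd; otherwise the
  lowest digits decide.\<close>

lemma pascal_disjoint:
  "Suc a AND Suc b = 0 \<longleftrightarrow> (a AND Suc b = 0) \<noteq> (Suc a AND b = 0)" for a b :: nat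
proof (induction "a + b" arbitrary: a b rule: less_induct)
  case less
  show ?case
  proof (cases "odd a \<and> odd b")
    case True
    then obtain a' b' where ab: "a = 2 * a' + 1" "b = 2 * b' + 1"
      by (auto elim!: oddE)
    show ?thesis
      using less[of a' b']
      unfolding and_eq_0_rec[of "Suc a" "Suc b"] and_eq_0_rec[of a "Suc b"]
        and_eq_0_rec[of "Suc a" b]
      by (simp add: ab)
  next
    case False
    then show ?thesis
      unfolding and_eq_0_rec[of "Suc a" "Suc b"] and_eq_0_rec[of a "Suc b"]
        and_eq_0_rec[of "Suc a" b]
      by (cases "odd a"; cases "odd b") simp_all
  qed
qed

text \<open>Equivalently, the Stirling number is congruent to \<open>(a + k div 2) choose a\<close>
  modulo 2.\<close>

lemma odd_Stirling_iff:
  "odd (Stirling (Suc k + a) (Suc k)) \<longleftrightarrow> a AND (k div 2) = 0"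
proof (induction "k + a" arbitrary: k a rule: less_induct)
  case less
  show ?case
  proof (cases a)
    case [simp]: (Suc b)
    show ?thesis
    proof (cases k)
      case 0
      then show ?thesis using Stirling_1[of a] by (simp del: Stirling.simps)
    next
      case [simp]: (Suc j)
      have rec: "Stirling (Suc k + a) (Suc k) =
          Suc k * Stirling (Suc k + b) (Suc k) + Stirling (Suc j + a) (Suc j)"
        by simp
      have IH: "odd (Stirling (Suc k + b) (Suc k)) \<longleftrightarrow> b AND (k div 2) = 0"
          "odd (Stirling (Suc j + a) (Suc j)) \<longleftrightarrow> a AND (j div 2) = 0"
        by (rule less.hyps; simp)+
      \<comment> \<open>For odd \<open>k\<close> the factor \<open>Suc k\<close> kills the first
        summand and \<open>j div 2 = k div 2\<close>; for even \<open>k\<close> both summands remain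
        and \<open>j div 2\<close> is one less than \<open>k div 2\<close>, as in Pascal's
        rule.\<close>
      have "odd (Stirling (Suc k + a) (Suc k)) \<longleftrightarrow>
          (even k \<and> b AND (k div 2) = 0) \<noteq> (a AND (j div 2) = 0)"
        unfolding rec even_add even_mult_iff even_Suc[of k] IH[symmetric] by blast
      also have "\<dots> \<longleftrightarrow> a AND (k div 2) = 0"
      proof (cases "even k")
        case True
        then obtain i where "k div 2 = Suc i" "j div 2 = i"
          by (auto elim!: oddE)
        then show ?thesis
          using True pascal_disjoint[of b i] by simp
      qed (auto elim!: evenE)
      finally show ?thesis .
    qed
  qed simp
qed

section \<open>Binary digit sums and shared digits\<close>

text \<open>The bound in the definition of \<open>\<sigma>\<close> varies with the argument; a
  common bound lets \<open>m\<close> be compared with \<open>m div 2\<close>.\<close>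

lemma digit_sum_upto:
  assumes "m \<le> N"
  shows "\<sigma> m = (\<Sum>i<N. m div 2 ^ i mod 2)"
  unfolding digit_sum_def
proof (rule sum.mono_neutral_left)
  show "\<forall>i\<in>{..<N} - {..<m}. m div 2 ^ i mod 2 = 0"
  proof
    fix i assume "i \<in> {..<N} - {..<m}"
    then have "m < 2 ^ i"
      by (metis DiffE lessThan_iff less_exp not_less order_le_less_trans)
    then show "m div 2 ^ i mod 2 = 0" by simp
  qed
qed (use assms in auto)

lemma digit_sum_rec: "\<sigma> m = m mod 2 + \<sigma> (m div 2)"
proof -
  \<comment> \<open>One extra term, so that \<open>m\<close> terms remain once the lowest digit is
    split off, even for \<open>m = 0\<close>.\<close>
  have "\<sigma> m = (\<Sum>i<Suc m. m div 2 ^ i mod 2)"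
    by (rule digit_sum_upto) simp
  also have "\<dots> = m mod 2 + (\<Sum>i<m. m div 2 div 2 ^ i mod 2)"
    by (subst sum.lessThan_Suc_shift) (simp add: div_mult2_eq)
  also have "(\<Sum>i<m. m div 2 div 2 ^ i mod 2) = \<sigma> (m div 2)"
    by (rule digit_sum_upto[symmetric]) simp
  finally show ?thesis .
qed

lemma digit_sum_0 [simp]: "\<sigma> 0 = 0"
  by (simp add: digit_sum_def)

lemma digit_sum_double [simp]: "\<sigma> (2 * m) = \<sigma> m"
  by (subst digit_sum_rec) simp

lemma digit_sum_Suc_double [simp]: "\<sigma> (Suc (2 * m)) = Suc (\<sigma> m)"
  by (subst digit_sum_rec) simp

lemma digit_sum_eq_card: "\<sigma> m = card {i. bit m i}"
proof -
  have "\<sigma> m = (\<Sum>i<m. of_bool (bit m i))"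
    unfolding digit_sum_def by (intro sum.cong) (auto simp: bit_iff_odd mod2_eq_if)
  also have "\<dots> = card ({..<m} \<inter> {i. bit m i})"
    by simp
  also have "{..<m} \<inter> {i. bit m i} = {i. bit m i}"
  proof -
    have "i < m" if "bit m i" for i
    proof -
      have "2 ^ i \<le> m"
        using that by (metis bit_iff_odd div_less even_zero not_le)
      then show ?thesis
        using less_exp[of i] by linarith
    qed
    then show ?thesis by auto
  qed
  finally show ?thesis .
qed

text \<open>Distinct exponents give distinct powers of 2, so the intersection can be counted by bit
  positions. As a digit sum it can be computed by halving.\<close>

lemma common_powers_eq_digit_sum: "common_powers a b = int (\<sigma> (a AND b))"
proof -
  have powers: "binary_powers m = (\<lambda>i. 2 ^ i) ` {i. bit m i}" for m
    by (auto simp: binary_powers_def bit_iff_odd odd_iff_mod_2_eq_one)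
  have inj: "inj (\<lambda>i. 2 ^ i :: nat)"
    by (auto simp: inj_on_def)
  have "binary_powers a \<inter> binary_powers b = (\<lambda>i. 2 ^ i) ` {i. bit (a AND b) i}"
    unfolding powers image_Int[OF inj, symmetric] by (auto simp: bit_and_iff)
  then show ?thesis
    using inj by (simp add: common_powers_def digit_sum_eq_card card_image inj_on_subset[of _ UNIV])
qed

lemma digit_sum_and_rec:
  "\<sigma> (a AND b) = (a mod 2) * (b mod 2) + \<sigma> ((a div 2) AND (b div 2))"
  by (subst and_rec) (auto simp: mod2_eq_if)

lemma digit_sum_and_double [simp]:
  "\<sigma> (2 * a AND 2 * b) = \<sigma> (a AND b)"
  "\<sigma> (2 * a AND Suc (2 * b)) = \<sigma> (a AND b)"
  "\<sigma> (Suc (2 * a) AND 2 * b) = \<sigma> (a AND b)"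
  "\<sigma> (Suc (2 * a) AND Suc (2 * b)) = Suc (\<sigma> (a AND b))"
  by (simp_all add: digit_sum_and_rec[of "2 * a"] digit_sum_and_rec[of "Suc (2 * a)"])

text \<open>Carries force the two identities to be proved simultaneously: halving with an incoming carry
  replaces \<open>m\<close> by \<open>Suc (m div 2)\<close>, and disjointness makes \<open>m div 2\<close> even whenever \<open>a\<close> is odd.\<close>

lemma digit_sum_add:
  assumes "a AND (m div 2) = 0"
  shows "\<sigma> (m + a) = \<sigma> m + \<sigma> ((m + a) AND a)"
    and "\<sigma> (Suc m + a) = \<sigma> (Suc m) + \<sigma> ((Suc m + a) AND a)"
proof -
  have "\<sigma> (m + a) = \<sigma> m + \<sigma> ((m + a) AND a) \<and>
      \<sigma> (Suc m + a) = \<sigma> (Suc m) + \<sigma> ((Suc m + a) AND a)"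
    using assms
  proof (induction "m + a" arbitrary: m a rule: less_induct)
    case less
    define h b where "h = m div 2" and "b = a div 2"
    show ?case
    proof (cases "m + a = 0")
      case False
      have disj: "odd a \<Longrightarrow> even h" "b AND (h div 2) = 0"
        using less.prems and_eq_0_rec[of a h] by (auto simp: h_def b_def)
      have IH: "\<sigma> (h + b) = \<sigma> h + \<sigma> ((h + b) AND b)"
          "\<sigma> (Suc (h + b)) = \<sigma> (Suc h) + \<sigma> (Suc (h + b) AND b)"
        using less.hyps[of h b] disj False by (auto simp: h_def b_def)
      \<comment> \<open>If \<open>a\<close> and the other summand \<open>Suc (2 * h)\<close> are
        both odd, the total is \<open>2 * Suc (h + b)\<close>. The second identity for the halves
        then yields \<open>\<sigma> (Suc h)\<close>, which has to match
        \<open>\<sigma> (Suc (2 * h))\<close>.\<close>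
      have suc: "\<sigma> (Suc h) = Suc (\<sigma> h)" if "odd a"
        using disj(1)[OF that] by (auto elim!: evenE)
      show ?thesis
      proof (cases "even m"; cases "even a")
        assume "even m" and "even a"
        then have ma: "m = 2 * h" "a = 2 * b"
          by (simp_all add: h_def b_def)
        then have sums: "m + a = 2 * (h + b)" "Suc m + a = Suc (2 * (h + b))"
            "Suc m = Suc (2 * h)"
          by simp_all
        show ?thesis
          unfolding sums(1,2) unfolding sums(3) unfolding ma
          by (simp only: digit_sum_double digit_sum_Suc_double digit_sum_and_double IH
              add_Suc add_Suc_right)
      next
        assume "even m" and odd: "odd a"
        then have ma: "m = 2 * h" "a = Suc (2 * b)"
          by (simp_all add: h_def b_def)
        then have sums: "m + a = Suc (2 * (h + b))" "Suc m + a = 2 * Suc (h + b)"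
            "Suc m = Suc (2 * h)"
          by simp_all
        show ?thesis
          unfolding sums(1,2) unfolding sums(3) unfolding ma
          by (simp only: digit_sum_double digit_sum_Suc_double digit_sum_and_double IH suc[OF odd]
              add_Suc add_Suc_right)
      next
        assume "odd m" and "even a"
        then have ma: "m = Suc (2 * h)" "a = 2 * b"
          by (simp_all add: h_def b_def)
        then have sums: "m + a = Suc (2 * (h + b))" "Suc m + a = 2 * Suc (h + b)"
            "Suc m = 2 * Suc h"
          by simp_all
        show ?thesis
          unfolding sums(1,2) unfolding sums(3) unfolding ma
          by (simp only: digit_sum_double digit_sum_Suc_double digit_sum_and_double IH
              add_Suc add_Suc_right)
      next
        assume "odd m" and odd: "odd a"
        then have ma: "m = Suc (2 * h)" "a = Suc (2 * b)"
          by (simp_all add: h_def b_def)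
        then have sums: "m + a = 2 * Suc (h + b)" "Suc m + a = Suc (2 * Suc (h + b))"
            "Suc m = 2 * Suc h"
          by simp_all
        show ?thesis
          unfolding sums(1,2) unfolding sums(3) unfolding ma
          by (simp only: digit_sum_double digit_sum_Suc_double digit_sum_and_double IH suc[OF odd]
              add_Suc add_Suc_right)
      qed
    qed simp
  qed
  then show "\<sigma> (m + a) = \<sigma> m + \<sigma> ((m + a) AND a)"
    and "\<sigma> (Suc m + a) = \<sigma> (Suc m) + \<sigma> ((Suc m + a) AND a)"
    by blast+
qed

section \<open>Parity, valuation and the equivalences\<close>

lemma odd_Stirling_digit_sums:
  assumes "1 \<le> k" "k \<le> n" "odd (Stirling n k)"
  shows "common_powers n (n - k) = int (\<sigma> n) - int (\<sigma> k)"
    and "common_powers (n - 1) (n - k) = int (\<sigma> (n - 1)) - int (\<sigma> (k - 1))"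
proof -
  obtain m where k: "k = Suc m"
    using assms(1) by (cases k) auto
  obtain a where n: "n = k + a"
    using assms(2) le_Suc_ex by blast
  have "a AND (m div 2) = 0"
    using assms(3) unfolding k n odd_Stirling_iff .
  \<comment> \<open>Since \<open>n = Suc m + a\<close>, the second identity concerns
    \<open>n\<close> and \<open>k\<close>, the first \<open>n - 1\<close> and
    \<open>k - 1\<close>.\<close>
  from digit_sum_add[OF this]
  show "common_powers n (n - k) = int (\<sigma> n) - int (\<sigma> k)"
    and "common_powers (n - 1) (n - k) = int (\<sigma> (n - 1)) - int (\<sigma> (k - 1))"
    by (simp_all add: k n common_powers_eq_digit_sum)
qed

text \<open>Excludes the default value \<open>multiplicity 2 0 = 0\<close>, for which valuation 0
  would not mean odd.\<close>

lemma Stirling_pos: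
  assumes "1 \<le> k" "k \<le> n"
  shows "Stirling n k > 0"
  using assms
proof (induction n arbitrary: k)
  case (Suc n)
  show ?case
  proof (cases "k = 1")
    case True
    then show ?thesis
      using Stirling_1[of n] by (simp del: Stirling.simps)
  next
    case False
    then obtain j where k: "k = Suc j" "1 \<le> j"
      using Suc.prems(1) by (cases k) auto
    \<comment> \<open>This summand of the recurrence is positive even for \<open>k = Suc n\<close>,
      where the other one vanishes.\<close>
    then have "0 < Stirling n j"
      using Suc.prems(2) by (intro Suc.IH) auto
    then show ?thesis
      unfolding k(1) Stirling.simps by (rule trans_less_add2)
  qed
qed simp

lemma odd_Stirling_iff_nu:
  assumes "1 \<le> k" "k \<le> n"
  shows "odd (Stirling n k) \<longleftrightarrow> nu_Stirling n k = 0"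
  using Stirling_pos[OF assms]
  by (auto simp: nu_Stirling_def multiplicity_eq_zero_iff not_dvd_imp_multiplicity_0)

theorem theorem3p2:
  fixes n k :: nat
  assumes "1 \<le> k" and "k \<le> n"
  shows
    "(odd (Stirling n k) \<longleftrightarrow>
        common_powers n (n - k) = int (\<sigma> n) - int (\<sigma> k) \<and>
        nu_Stirling n k = int (\<sigma> k) - int (\<sigma> n) + common_powers n (n - k)) \<and>
     (odd (Stirling n k) \<longleftrightarrow>
        common_powers n (n - k) = int (\<sigma> n) - int (\<sigma> k) \<and>
        (MZC n k \<or> AMZC n k)) \<and>
     (odd (Stirling n k) \<longleftrightarrow>
        common_powers (n - 1) (n - k) = int (\<sigma> (n - 1)) - int (\<sigma> (k - 1)) \<and>
        nu_Stirling n k = int (\<sigma> (k - 1)) - int (\<sigma> (n - 1)) + common_powers (n - 1) (n - k)) \<and>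
     (odd (Stirling n k) \<longleftrightarrow>
        common_powers (n - 1) (n - k) = int (\<sigma> (n - 1)) - int (\<sigma> (k - 1)) \<and>
        (SMZC n k \<or> SAMZC n k))"
proof -
  have nonneg: "nu_Stirling n k \<ge> 0" "common_powers n (n - k) \<ge> 0"
      "common_powers (n - 1) (n - k) \<ge> 0"
    by (simp_all add: nu_Stirling_def common_powers_def)
  show ?thesis
  proof (cases "odd (Stirling n k)")
    case True
    then have "nu_Stirling n k = 0"
      using odd_Stirling_iff_nu[OF assms] by blast
    with True odd_Stirling_digit_sums[OF assms True] show ?thesis
      unfolding MZC_def AMZC_def SMZC_def SAMZC_def by simp
  next
    case False
    then have "nu_Stirling n k > 0"
      using odd_Stirling_iff_nu[OF assms] nonneg(1) by linarith
    \<comment> \<open>Given the digit condition, the almost minimum cases make the valuation 0 and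
      the minimum cases make it minus a cardinality; both contradict positivity.\<close>
    with False nonneg(2,3) show ?thesis
      unfolding MZC_def AMZC_def SMZC_def SAMZC_def by auto
  qed
qed

end
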